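(* Let $R$ be a von Neumann regular ring with identity and let $a,b\in R$. Then the following are equivalent: (1) $a\leq^{\oplus} b$; (2) $a\leq^{-} b$; (3) $\{b^{(1)}\}\subseteq\{a^{(1)}\}$, i.e. every von Neumann inverse of $b$ is a von Neumann inverse of $a$.
   Context: A ring $R$ with identity is von Neumann regular if for every $r\in R$ there is $x\in R$ with $rxr=r$; such an $x$ is called a von Neumann inverse of $r$, and $\{r^{(1)}\}$ denotes the set of all von Neumann inverses of $r$. Direct sum partial order: $a\leq^{\oplus} b$ means $bR=aR\oplus(b-a)R$ (that is, $bR=aR+(b-a)R$ and $aR\cap(b-a)R=(0)$). Minus partial order: $a\leq^{-} b$ means there exists $x\in R$ with $axa=a$, $ax=bx$ and $xa=xb$. *)

theory Defs
  imports "HOL-Algebra.Algebra"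
begin

definition vn_inverses :: "('a, 'b) ring_scheme \<Rightarrow> 'a \<Rightarrow> 'a set" where
  "vn_inverses R r = {x \<in> carrier R. r \<otimes>\<^bsub>R\<^esub> x \<otimes>\<^bsub>R\<^esub> r = r}"

locale von_neumann_regular_ring = ring R for R (structure) +
  assumes ex_vn_inverse: "r \<in> carrier R \<Longrightarrow> \<exists>x \<in> carrier R. r \<otimes> x \<otimes> r = r"

text \<open>The coset notation \<open>a <#\<^bsub>R\<^esub> carrier R\<close> is taken in the multiplicative monoid of \<open>R\<close>,
  so it is the principal right ideal \<open>a R\<close>.\<close>

definition direct_sum_le :: "('a, 'b) ring_scheme \<Rightarrow> 'a \<Rightarrow> 'a \<Rightarrow> bool" where
  "direct_sum_le R a b \<longleftrightarrow>
     b <#\<^bsub>R\<^esub> carrier R = (a <#\<^bsub>R\<^esub> carrier R) <+>\<^bsub>R\<^esub> ((b \<ominus>\<^bsub>R\<^esub> a) <#\<^bsub>R\<^esub> carrier R) \<and>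
     (a <#\<^bsub>R\<^esub> carrier R) \<inter> ((b \<ominus>\<^bsub>R\<^esub> a) <#\<^bsub>R\<^esub> carrier R) = {\<zero>\<^bsub>R\<^esub>}"

definition minus_le :: "('a, 'b) ring_scheme \<Rightarrow> 'a \<Rightarrow> 'a \<Rightarrow> bool" where
  "minus_le R a b \<longleftrightarrow>
     (\<exists>x \<in> carrier R. a \<otimes>\<^bsub>R\<^esub> x \<otimes>\<^bsub>R\<^esub> a = a \<and>
        a \<otimes>\<^bsub>R\<^esub> x = b \<otimes>\<^bsub>R\<^esub> x \<and> x \<otimes>\<^bsub>R\<^esub> a = x \<otimes>\<^bsub>R\<^esub> b)"

end

theory Submission
  imports Defs
begin

text \<open>
  The equivalence is the cycle (1) \<open>\<Longrightarrow>\<close> (3) \<open>\<Longrightarrow>\<close> (2) \<open>\<Longrightarrow>\<close> (1). Put \<open>c = b - a\<close>.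

  If \<open>bR = aR \<oplus> cR\<close> and \<open>bxb = b\<close>, then left multiplication by \<open>bx\<close> fixes \<open>bR\<close>, so
  \<open>a = bxa = axa + cxa\<close>. Thus \<open>a - axa = cxa\<close> lies in \<open>aR \<inter> cR = 0\<close>, and \<open>axa = a\<close>
  (\<open>direct_sum_le_imp_vn_inverses_subset\<close>).

  Suppose that every inverse of \<open>b\<close> is an inverse of \<open>a\<close>, and fix an inverse \<open>g\<close> of \<open>b\<close>.
  All the elements \<open>g + (1 - gb)v\<close> and \<open>g + v(1 - bg)\<close> are inverses of \<open>b\<close> as well.
  Comparing them with \<open>g\<close> as inverses of \<open>a\<close> gives \<open>(a - agb)va = 0\<close> and
  \<open>av(a - bga) = 0\<close> for all \<open>v\<close>, and regularity of the ring turns this into \<open>a = agb = bga\<close>.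
  Hence \<open>gag\<close> is a witness for the minus order (\<open>vn_inverses_subset_imp_minus_le\<close>).

  Finally, if \<open>x\<close> is a witness for the minus order, then \<open>a = b(xa)\<close> and \<open>c = b(1 - xa)\<close> lie
  in \<open>bR\<close>, while left multiplication by \<open>ax\<close> is the identity on \<open>aR\<close> and kills \<open>cR\<close>
  (\<open>minus_le_imp_direct_sum_le\<close>).
\<close>

lemma in_principal_right_ideal_iff:
  "y \<in> r <#\<^bsub>R\<^esub> carrier R \<longleftrightarrow> (\<exists>s \<in> carrier R. y = r \<otimes>\<^bsub>R\<^esub> s)"
  by (auto simp: l_coset_def)

lemma in_sum_of_principal_right_ideals_iff:
  "y \<in> (r <#\<^bsub>R\<^esub> carrier R) <+>\<^bsub>R\<^esub> (s <#\<^bsub>R\<^esub> carrier R) \<longleftrightarrow>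
    (\<exists>u \<in> carrier R. \<exists>v \<in> carrier R. y = r \<otimes>\<^bsub>R\<^esub> u \<oplus>\<^bsub>R\<^esub> s \<otimes>\<^bsub>R\<^esub> v)"
  by (auto simp: set_add_def' l_coset_def)

context ring
begin

lemma r_minus_distr:
  assumes "x \<in> carrier R" "y \<in> carrier R" "z \<in> carrier R"
  shows "x \<otimes> (y \<ominus> z) = x \<otimes> y \<ominus> x \<otimes> z"
  using assms by (simp add: minus_eq r_distr r_minus)

lemma l_minus_distr:
  assumes "x \<in> carrier R" "y \<in> carrier R" "z \<in> carrier R"
  shows "(y \<ominus> z) \<otimes> x = y \<otimes> x \<ominus> z \<otimes> x"
  using assms by (simp add: minus_eq l_distr l_minus)

lemma direct_sum_le_imp_vn_inverses_subset:
  assumes a: "a \<in> carrier R" and b: "b \<in> carrier R" and le: "direct_sum_le R a b"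
  shows "vn_inverses R b \<subseteq> vn_inverses R a"
proof
  fix x assume "x \<in> vn_inverses R b"
  then have x: "x \<in> carrier R" and bxb: "b \<otimes> x \<otimes> b = b"
    by (auto simp: vn_inverses_def)
  define c where "c = b \<ominus> a"
  have c: "c \<in> carrier R" using a b by (simp add: c_def)
  have sum: "b <#\<^bsub>R\<^esub> carrier R = (a <#\<^bsub>R\<^esub> carrier R) <+>\<^bsub>R\<^esub> (c <#\<^bsub>R\<^esub> carrier R)"
    and int: "(a <#\<^bsub>R\<^esub> carrier R) \<inter> (c <#\<^bsub>R\<^esub> carrier R) = {\<zero>}"
    using le by (auto simp: direct_sum_le_def c_def)
  have "a = a \<otimes> \<one> \<oplus> c \<otimes> \<zero>" using a c by simp
  then have "a \<in> b <#\<^bsub>R\<^esub> carrier R"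
    unfolding sum in_sum_of_principal_right_ideals_iff by blast
  then obtain u where u: "u \<in> carrier R" and au: "a = b \<otimes> u"
    by (auto simp: in_principal_right_ideal_iff)
  have "b \<otimes> x \<otimes> a = (b \<otimes> x \<otimes> b) \<otimes> u" using au b x u by (simp add: m_assoc)
  then have bxa: "b \<otimes> x \<otimes> a = a" using bxb au by simp
  have cxa: "c \<otimes> (x \<otimes> a) = a \<otimes> (\<one> \<ominus> x \<otimes> a)"
  proof -
    have "c \<otimes> (x \<otimes> a) = b \<otimes> (x \<otimes> a) \<ominus> a \<otimes> (x \<otimes> a)"
      using a b x by (simp add: c_def l_minus_distr)
    also have "\<dots> = a \<ominus> a \<otimes> (x \<otimes> a)" using bxa a b x by (simp add: m_assoc)
    finally show ?thesis using a x by (simp add: r_minus_distr)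
  qed
  have "a \<otimes> (\<one> \<ominus> x \<otimes> a) \<in> a <#\<^bsub>R\<^esub> carrier R"
    using a x by (auto simp: in_principal_right_ideal_iff)
  moreover have "a \<otimes> (\<one> \<ominus> x \<otimes> a) \<in> c <#\<^bsub>R\<^esub> carrier R"
    unfolding cxa[symmetric] using a x by (auto simp: in_principal_right_ideal_iff)
  ultimately have "a \<otimes> (\<one> \<ominus> x \<otimes> a) = \<zero>" using int by blast
  then have "a \<ominus> a \<otimes> x \<otimes> a = \<zero>" using a x by (simp add: r_minus_distr m_assoc)
  then have "a \<otimes> x \<otimes> a = a" using a x by (metis m_closed r_right_minus_eq)
  then show "x \<in> vn_inverses R a" using x by (simp add: vn_inverses_def)
qed

lemma minus_le_imp_direct_sum_le:
  assumes a: "a \<in> carrier R" and b: "b \<in> carrier R" and le: "minus_le R a b"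
  shows "direct_sum_le R a b"
proof -
  obtain x where x: "x \<in> carrier R" and axa: "a \<otimes> x \<otimes> a = a"
    and ax: "a \<otimes> x = b \<otimes> x" and xa: "x \<otimes> a = x \<otimes> b"
    using le by (auto simp: minus_le_def)
  define c where "c = b \<ominus> a"
  have c: "c \<in> carrier R" using a b by (simp add: c_def)
  have b_eq: "b = a \<oplus> c" using a b by (simp add: c_def minus_eq a_comm[of b] r_neg2)
  have a_eq: "b \<otimes> (x \<otimes> a) = a" using axa ax a b x by (simp add: m_assoc[symmetric])
  have c_eq: "b \<otimes> (\<one> \<ominus> x \<otimes> a) = c" using a_eq a b x by (simp add: r_minus_distr c_def)
  have xc: "x \<otimes> c = \<zero>"
    using xa a b x by (simp add: c_def r_minus_distr)
  have "b <#\<^bsub>R\<^esub> carrier R = (a <#\<^bsub>R\<^esub> carrier R) <+>\<^bsub>R\<^esub> (c <#\<^bsub>R\<^esub> carrier R)"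
  proof (intro equalityI subsetI)
    fix y assume "y \<in> b <#\<^bsub>R\<^esub> carrier R"
    then obtain r where r: "r \<in> carrier R" "y = b \<otimes> r"
      by (auto simp: in_principal_right_ideal_iff)
    then have "y = a \<otimes> r \<oplus> c \<otimes> r" using b_eq a c by (simp add: l_distr)
    then show "y \<in> (a <#\<^bsub>R\<^esub> carrier R) <+>\<^bsub>R\<^esub> (c <#\<^bsub>R\<^esub> carrier R)"
      unfolding in_sum_of_principal_right_ideals_iff using r by blast
  next
    fix y assume "y \<in> (a <#\<^bsub>R\<^esub> carrier R) <+>\<^bsub>R\<^esub> (c <#\<^bsub>R\<^esub> carrier R)"
    then obtain u v where uv: "u \<in> carrier R" "v \<in> carrier R" and y: "y = a \<otimes> u \<oplus> c \<otimes> v"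
      unfolding in_sum_of_principal_right_ideals_iff by blast
    have "b \<otimes> (x \<otimes> a \<otimes> u \<oplus> (\<one> \<ominus> x \<otimes> a) \<otimes> v)
        = (b \<otimes> (x \<otimes> a)) \<otimes> u \<oplus> (b \<otimes> (\<one> \<ominus> x \<otimes> a)) \<otimes> v"
      using uv a b x by (simp add: r_distr m_assoc)
    then have "y = b \<otimes> (x \<otimes> a \<otimes> u \<oplus> (\<one> \<ominus> x \<otimes> a) \<otimes> v)"
      using y a_eq c_eq by simp
    then show "y \<in> b <#\<^bsub>R\<^esub> carrier R"
      unfolding in_principal_right_ideal_iff using uv a x by blast
  qed
  moreover have "(a <#\<^bsub>R\<^esub> carrier R) \<inter> (c <#\<^bsub>R\<^esub> carrier R) = {\<zero>}"
  proof (intro equalityI subsetI)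
    fix y assume "y \<in> (a <#\<^bsub>R\<^esub> carrier R) \<inter> (c <#\<^bsub>R\<^esub> carrier R)"
    then obtain u v where uv: "u \<in> carrier R" "v \<in> carrier R"
      and y: "y = a \<otimes> u" "y = c \<otimes> v"
      by (auto simp: in_principal_right_ideal_iff)
    have "y = a \<otimes> x \<otimes> a \<otimes> u" using y(1) axa by simp
    also have "\<dots> = a \<otimes> x \<otimes> y" using y(1) uv a x by (simp add: m_assoc)
    also have "\<dots> = a \<otimes> ((x \<otimes> c) \<otimes> v)" using y(2) uv a c x by (simp add: m_assoc)
    finally show "y \<in> {\<zero>}" using xc uv a by simp
  next
    fix y assume "y \<in> {\<zero>}"
    then show "y \<in> (a <#\<^bsub>R\<^esub> carrier R) \<inter> (c <#\<^bsub>R\<^esub> carrier R)"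
      using a c by (auto simp: in_principal_right_ideal_iff intro!: bexI[of _ \<zero>])
  qed
  ultimately show ?thesis by (simp add: direct_sum_le_def c_def)
qed

end

context von_neumann_regular_ring
begin

text \<open>If \<open>d = as\<close> and \<open>dzd = d\<close>, then \<open>d = (dza)s\<close>. The next lemma is the mirror image.\<close>

lemma zero_if_annihilates_generator_right:
  assumes a: "a \<in> carrier R" and s: "s \<in> carrier R"
    and ann: "\<And>v. v \<in> carrier R \<Longrightarrow> (a \<otimes> s) \<otimes> v \<otimes> a = \<zero>"
  shows "a \<otimes> s = \<zero>"
proof -
  obtain z where z: "z \<in> carrier R" and "(a \<otimes> s) \<otimes> z \<otimes> (a \<otimes> s) = a \<otimes> s"
    using ex_vn_inverse a s by blast
  then have "a \<otimes> s = ((a \<otimes> s) \<otimes> z \<otimes> a) \<otimes> s" using a s by (simp add: m_assoc)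
  then show ?thesis using ann[OF z] s by simp
qed

lemma zero_if_annihilates_generator_left:
  assumes a: "a \<in> carrier R" and s: "s \<in> carrier R"
    and ann: "\<And>v. v \<in> carrier R \<Longrightarrow> a \<otimes> v \<otimes> (s \<otimes> a) = \<zero>"
  shows "s \<otimes> a = \<zero>"
proof -
  obtain z where z: "z \<in> carrier R" and "(s \<otimes> a) \<otimes> z \<otimes> (s \<otimes> a) = s \<otimes> a"
    using ex_vn_inverse a s by blast
  then have "s \<otimes> a = s \<otimes> (a \<otimes> z \<otimes> (s \<otimes> a))" using a s by (simp add: m_assoc)
  then show ?thesis using ann[OF z] s by simp
qed

lemma vn_inverses_subset_imp_minus_le:
  assumes a: "a \<in> carrier R" and b: "b \<in> carrier R"
    and sub: "vn_inverses R b \<subseteq> vn_inverses R a"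
  shows "minus_le R a b"
proof -
  obtain g where g: "g \<in> carrier R" and bgb: "b \<otimes> g \<otimes> b = b"
    using ex_vn_inverse b by blast
  have inv_a: "a \<otimes> h \<otimes> a = a" if "h \<in> carrier R" "b \<otimes> h \<otimes> b = b" for h
    using sub that by (auto simp: vn_inverses_def)
  have aga: "a \<otimes> g \<otimes> a = a" by (rule inv_a[OF g bgb])
  \<comment> \<open>If \<open>bwb = 0\<close>, then \<open>g + w\<close> is again an inverse of \<open>b\<close>; compare it with \<open>g\<close>.\<close>
  have perturb: "a \<otimes> w \<otimes> a = \<zero>" if w: "w \<in> carrier R" and bwb: "b \<otimes> w \<otimes> b = \<zero>" for w
  proof -
    have "b \<otimes> (g \<oplus> w) \<otimes> b = b"
      using b g w bgb bwb by (simp add: r_distr l_distr)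
    then have "a \<otimes> (g \<oplus> w) \<otimes> a = a" using g w by (intro inv_a) auto
    then have "a \<oplus> a \<otimes> w \<otimes> a = a" using a g w aga by (simp add: r_distr l_distr)
    then show ?thesis using a w by simp
  qed
  define p where "p = \<one> \<ominus> g \<otimes> b"
  define q where "q = \<one> \<ominus> b \<otimes> g"
  have p: "p \<in> carrier R" and q: "q \<in> carrier R" using b g by (auto simp: p_def q_def)
  have bp: "b \<otimes> p = \<zero>"
    using b g bgb by (simp add: p_def r_minus_distr m_assoc[symmetric])
  have qb: "q \<otimes> b = \<zero>"
    using b g bgb by (simp add: q_def l_minus_distr)
  have "a \<otimes> p = \<zero>"
  proof (rule zero_if_annihilates_generator_right[OF a p])
    fix v assume v: "v \<in> carrier R"
    have "b \<otimes> (p \<otimes> v) \<otimes> b = (b \<otimes> p) \<otimes> v \<otimes> b" using b p v by (simp add: m_assoc)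
    then have "a \<otimes> (p \<otimes> v) \<otimes> a = \<zero>" using bp b p v by (intro perturb) auto
    then show "(a \<otimes> p) \<otimes> v \<otimes> a = \<zero>" using a p v by (simp add: m_assoc)
  qed
  then have "a \<ominus> a \<otimes> g \<otimes> b = \<zero>" using a b g by (simp add: p_def r_minus_distr m_assoc)
  then have agb: "a \<otimes> g \<otimes> b = a" using a b g by (metis m_closed r_right_minus_eq)
  have "q \<otimes> a = \<zero>"
  proof (rule zero_if_annihilates_generator_left[OF a q])
    fix v assume v: "v \<in> carrier R"
    have "b \<otimes> (v \<otimes> q) \<otimes> b = b \<otimes> v \<otimes> (q \<otimes> b)" using b q v by (simp add: m_assoc)
    then have "a \<otimes> (v \<otimes> q) \<otimes> a = \<zero>" using qb b q v by (intro perturb) auto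
    then show "a \<otimes> v \<otimes> (q \<otimes> a) = \<zero>" using a q v by (simp add: m_assoc)
  qed
  then have "a \<ominus> b \<otimes> g \<otimes> a = \<zero>" using a b g by (simp add: q_def l_minus_distr)
  then have bga: "b \<otimes> g \<otimes> a = a" using a b g by (metis m_closed r_right_minus_eq)
  have "a \<otimes> (g \<otimes> a \<otimes> g) = (a \<otimes> g \<otimes> a) \<otimes> g" "b \<otimes> (g \<otimes> a \<otimes> g) = (b \<otimes> g \<otimes> a) \<otimes> g"
    "(g \<otimes> a \<otimes> g) \<otimes> a = g \<otimes> (a \<otimes> g \<otimes> a)" "(g \<otimes> a \<otimes> g) \<otimes> b = g \<otimes> (a \<otimes> g \<otimes> b)"
    using a b g by (simp_all add: m_assoc)
  then show ?thesis
    unfolding minus_le_def using a g aga agb bga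
    by (intro bexI[of _ "g \<otimes> a \<otimes> g"]) auto
qed

end

theorem lemma3:
  fixes R (structure) and a b
  assumes "von_neumann_regular_ring R"
    and "a \<in> carrier R" and "b \<in> carrier R"
  shows "(direct_sum_le R a b \<longleftrightarrow> minus_le R a b) \<and>
         (minus_le R a b \<longleftrightarrow> vn_inverses R b \<subseteq> vn_inverses R a)"
proof -
  interpret von_neumann_regular_ring R by fact
  note ab = assms(2,3)
  show ?thesis
    using direct_sum_le_imp_vn_inverses_subset[OF ab] vn_inverses_subset_imp_minus_le[OF ab]
      minus_le_imp_direct_sum_le[OF ab] by argo
qed

end
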